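(* Let $L>0$, $\Omega=(0,L)^2$, let $\beta\in\mathbb{R}^2$ be a constant vector and $\varepsilon>0$ a constant. Let $p\ge 2$ and let $U_h$ be the B-spline space of order $p$ on the uniform grid of $\Omega$ with element size $h$, with zero boundary values (see context). Let $C>0$ be a constant, independent of $h$, such that $\|\Delta v_h\|_{L_2}\le C h^{-1}\|\nabla v_h\|_{L_2}$ for all $v_h\in U_h$. Assume $\varepsilon\le \frac{1}{2}\,h/C^2$. Then the bilinear form $$b(u_h,v_h)=\frac1h\Big(\varepsilon(\nabla u_h,\nabla v_h)_\Omega+(\beta\cdot\nabla u_h,v_h)_\Omega\Big)+\big(-\varepsilon\Delta u_h+\beta\cdot\nabla u_h,\,-\varepsilon\Delta v_h+\beta\cdot\nabla v_h\big)_\Omega$$ satisfies $$b(v_h,v_h)\ge\frac12\left(\frac{\varepsilon}{h}\|\nabla v_h\|_{L_2}^2+\|\beta\cdot\nabla v_h\|_{L_2}^2\right)\qquad\text{for all } v_h\in U_h.$$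
   Context: $(\cdot,\cdot)_\Omega$ denotes the $L_2(\Omega)$ inner product (of scalar- or vector-valued functions) and $\|\cdot\|_{L_2}$ the corresponding norm. For an integer $n\ge1$, divide $\Omega=(0,L)^2$ uniformly into $n\times n$ equal square elements; the element size $h$ is the element diameter, $h=\sqrt2\,L/n$. $U_h$ is the space of tensor-product splines of order (polynomial degree) $p\ge2$ in each variable on this grid (i.e. functions that are polynomials of degree at most $p$ in each variable separately on each element), with the maximal smoothness $C^{p-1}$ in each variable across element interfaces (B-spline basis on an open knot vector without repeated interior knots), which vanish on $\partial\Omega$. In particular $U_h\subset H^2(\Omega)\cap H^1_0(\Omega)$. *)

theory Defs
  imports "HOL-Analysis.Analysis"
begin

definition partial_derivative :: "'a::real_normed_vector \<Rightarrow> ('a \<Rightarrow> real) \<Rightarrow> 'a \<Rightarrow> real" where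
  "partial_derivative i v z = deriv (\<lambda>t. v (z + t *\<^sub>R i)) 0"

definition gradient :: "('a::euclidean_space \<Rightarrow> real) \<Rightarrow> 'a \<Rightarrow> 'a" where
  "gradient v z = (\<Sum>i\<in>Basis. partial_derivative i v z *\<^sub>R i)"

(* The second derivatives of a spline of degree 2 may fail to exist on the grid lines.
   There deriv returns an unspecified value; this is a null set, and since the spline is
   continuously differentiable, the pointwise Laplacian represents the weak one. *)
definition laplacian :: "('a::euclidean_space \<Rightarrow> real) \<Rightarrow> 'a \<Rightarrow> real" where
  "laplacian v z = (\<Sum>i\<in>Basis. partial_derivative i (partial_derivative i v) z)"

(* The completed measure is used so that values on null sets are irrelevant. *)
definition L2_inner :: "'a::euclidean_space set \<Rightarrow> ('a \<Rightarrow> 'b::real_inner) \<Rightarrow> ('a \<Rightarrow> 'b) \<Rightarrow> real" where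
  "L2_inner S f g = (LINT z:S|lebesgue. f z \<bullet> g z)"

definition L2_norm :: "'a::euclidean_space set \<Rightarrow> ('a \<Rightarrow> 'b::real_inner) \<Rightarrow> real" where
  "L2_norm S f = sqrt (L2_inner S f f)"

definition square :: "real \<Rightarrow> (real \<times> real) set" where
  "square L = {0<..<L} \<times> {0<..<L}"

definition element :: "real \<Rightarrow> nat \<Rightarrow> nat \<Rightarrow> nat \<Rightarrow> (real \<times> real) set" where
  "element L n i j =
     {real i * L / real n .. real (i + 1) * L / real n} \<times>
     {real j * L / real n .. real (j + 1) * L / real n}"

definition element_size :: "real \<Rightarrow> nat \<Rightarrow> real" where
  "element_size L n = sqrt 2 * L / real n"

(* Meant for open S. *)
definition Ck_on :: "nat \<Rightarrow> (real \<Rightarrow> real) \<Rightarrow> real set \<Rightarrow> bool" where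
  "Ck_on k f S \<longleftrightarrow>
     (\<forall>j<k. ((deriv ^^ j) f) differentiable_on S) \<and> continuous_on S ((deriv ^^ k) f)"

(* Only the values on the closed square matter; members are unconstrained outside it.
   The elements are closed, so the pieces agree on common edges. For a piecewise
   polynomial, smoothness of all horizontal and all vertical sections is the same as
   membership in the tensor product of the univariate spline spaces. *)
definition spline_space :: "nat \<Rightarrow> real \<Rightarrow> nat \<Rightarrow> (real \<times> real \<Rightarrow> real) set" where
  "spline_space p L n = {v.
     (\<forall>i<n. \<forall>j<n. \<exists>c :: nat \<Rightarrow> nat \<Rightarrow> real. \<forall>(x, y)\<in>element L n i j.
        v (x, y) = (\<Sum>k\<le>p. \<Sum>l\<le>p. c k l * x ^ k * y ^ l)) \<and>
     (\<forall>y\<in>{0..L}. Ck_on (p - 1) (\<lambda>x. v (x, y)) {0<..<L}) \<and>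
     (\<forall>x\<in>{0..L}. Ck_on (p - 1) (\<lambda>y. v (x, y)) {0<..<L}) \<and>
     (\<forall>z\<in>frontier (square L). v z = 0)}"

definition bilinear_form ::
    "real \<Rightarrow> nat \<Rightarrow> real \<Rightarrow> real \<times> real \<Rightarrow> (real \<times> real \<Rightarrow> real) \<Rightarrow> (real \<times> real \<Rightarrow> real) \<Rightarrow> real" where
  "bilinear_form L n \<epsilon> \<beta> u v =
     1 / element_size L n *
       (\<epsilon> * L2_inner (square L) (gradient u) (gradient v)
        + L2_inner (square L) (\<lambda>z. \<beta> \<bullet> gradient u z) v)
     + L2_inner (square L)
         (\<lambda>z. - \<epsilon> * laplacian u z + \<beta> \<bullet> gradient u z)
         (\<lambda>z. - \<epsilon> * laplacian v z + \<beta> \<bullet> gradient v z)"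

end

theory Submission
  imports Defs
begin

text \<open>
  Since \<open>v\<close> vanishes on the boundary, \<open>(\<beta> \<bullet> \<nabla>v, v) = \<integral> \<beta> \<bullet> \<nabla>(v\<^sup>2/2) = 0\<close>. For the least-squares term,
  \<open>(-\<epsilon> \<Delta>v + w)\<^sup>2 \<ge> w\<^sup>2/2 - \<epsilon>\<^sup>2 (\<Delta>v)\<^sup>2\<close> pointwise with \<open>w = \<beta> \<bullet> \<nabla>v\<close>, and the inverse inequality
  together with \<open>\<epsilon> C\<^sup>2 \<le> h/2\<close> bounds \<open>\<epsilon>\<^sup>2 \<parallel>\<Delta>v\<parallel>\<^sup>2\<close> by half of the diffusion term. Integrability and the
  vanishing of the convective term are checked element by element: \<open>v\<close> is a polynomial on each
  element, and the boundary terms on interior grid lines telescope.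
\<close>

section \<open>Piecewise polynomials on the grid\<close>

definition node :: "real \<Rightarrow> nat \<Rightarrow> nat \<Rightarrow> real" where
  "node L n i = real i * L / real n"

lemma element_eq_cbox:
  "element L n i j = cbox (node L n i, node L n j) (node L n (Suc i), node L n (Suc j))"
  by (simp add: element_def node_def cbox_Pair_eq)

lemma interior_element:
  "interior (element L n i j) =
     {node L n i<..<node L n (Suc i)} \<times> {node L n j<..<node L n (Suc j)}"
  by (simp add: element_def node_def interior_Times)

lemma node_mono: "L > 0 \<Longrightarrow> i \<le> k \<Longrightarrow> node L n i \<le> node L n k"
  by (simp add: node_def divide_right_mono)

lemma node_0 [simp]: "node L n 0 = 0"
  by (simp add: node_def)

lemma node_n: "n \<ge> 1 \<Longrightarrow> node L n n = L"
  by (simp add: node_def)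

lemma node_interval_unique:
  assumes "L > 0" "x \<in> {node L n i<..<node L n (Suc i)}" "x \<in> {node L n k<..<node L n (Suc k)}"
  shows "i = k"
proof (rule ccontr)
  assume "i \<noteq> k"
  then consider "Suc i \<le> k" | "Suc k \<le> i" by linarith
  then show False
    using node_mono[OF assms(1), of "Suc i" k n] node_mono[OF assms(1), of "Suc k" i n] assms
    by cases auto
qed

lemma node_interval_exists:
  assumes "L > 0" "n \<ge> 1" "0 < x" "x < L" "x \<notin> node L n ` UNIV"
  obtains i where "i < n" "x \<in> {node L n i<..<node L n (Suc i)}"
proof -
  \<comment> \<open>Multiplying by \<open>real n / L\<close> rescales the nodes to the integers, so
    the floor is the index of the node at or to the left of \<open>x\<close>. The scaled value is
    nonnegative, so \<open>nat\<close> truncates nothing.\<close>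
  define i where "i = nat \<lfloor>x * real n / L\<rfloor>"
  have pos: "x * real n / L \<ge> 0" using assms by simp
  have 1: "real i \<le> x * real n / L" "x * real n / L < real (Suc i)"
    using pos unfolding i_def by linarith+
  then have 2: "node L n i \<le> x" "x < node L n (Suc i)"
    using assms by (auto simp: node_def field_simps)
  have "x * real n / L < real n" using assms by (simp add: field_simps)
  with 1 have "i < n" by linarith
  \<comment> \<open>The floor only gives a weak inequality on the left; it becomes strict because
    \<open>x\<close> is not a node.\<close>
  moreover have "node L n i \<noteq> x" using assms by auto
  ultimately show ?thesis using 2 that[of i] by auto
qed

lemma interior_element_disjoint:
  assumes "L > 0" "(i, j) \<noteq> (k, l)"
  shows "interior (element L n i j) \<inter> interior (element L n k l) = {}"
  using assms node_interval_unique[OF assms(1)] unfolding interior_element by blast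

lemma interior_element_subset_square:
  assumes "L > 0" "n \<ge> 1" "i < n" "j < n"
  shows "interior (element L n i j) \<subseteq> square L"
proof -
  have "node L n (Suc k) \<le> L" "0 \<le> node L n k" if "k < n" for k
    using node_mono[OF assms(1), of "Suc k" n n] node_mono[OF assms(1), of 0 k n]
      node_n[OF assms(2)] that by auto
  then show ?thesis
    using assms unfolding interior_element square_def by fastforce
qed

text \<open>A point of the square on no grid line has both coordinates strictly between consecutive
  nodes, hence lies inside an element. What remains is contained in countably many lines, each of
  measure zero in the plane.\<close>

lemma negligible_grid:
  assumes "L > 0" "n \<ge> 1"
  shows "negligible (square L - (\<Union>(i,j)\<in>{..<n} \<times> {..<n}. interior (element L n i j)))"
proof (rule negligible_subset)
  let ?G = "(\<Union>i. {z::real \<times> real. (1, 0) \<bullet> z = node L n i}) \<union>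
            (\<Union>i. {z::real \<times> real. (0, 1) \<bullet> z = node L n i})"
  show "negligible ?G"
    by (intro negligible_Un negligible_countable_Union)
      (auto intro!: negligible_hyperplane simp: prod_eq_iff)
  show "square L - (\<Union>(i,j)\<in>{..<n} \<times> {..<n}. interior (element L n i j)) \<subseteq> ?G"
  proof
    fix z assume z: "z \<in> square L - (\<Union>(i,j)\<in>{..<n} \<times> {..<n}. interior (element L n i j))"
    obtain x y where xy: "z = (x, y)" by fastforce
    show "z \<in> ?G"
    proof (rule ccontr)
      assume "z \<notin> ?G"
      then have "x \<notin> node L n ` UNIV" "y \<notin> node L n ` UNIV"
        by (auto simp: xy)
      moreover have "0 < x" "x < L" "0 < y" "y < L"
        using z by (auto simp: xy square_def)
      ultimately obtain i j where "i < n" "x \<in> {node L n i<..<node L n (Suc i)}"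
        "j < n" "y \<in> {node L n j<..<node L n (Suc j)}"
        using node_interval_exists[OF assms] by metis
      then have "z \<in> (\<Union>(i,j)\<in>{..<n} \<times> {..<n}. interior (element L n i j))"
        unfolding xy interior_element by blast
      with z show False by blast
    qed
  qed
qed

text \<open>The open elements are pairwise disjoint and fill the square up to a null set, so
  integrals add up. Agreement is asked for only on open elements: unspecified values of
  \<open>deriv\<close> on grid lines cannot matter. The pieces are merely continuous, which also
  admits absolute values of polynomials.\<close>

lemma has_integral_square_elementwise:
  fixes f :: "real \<times> real \<Rightarrow> real"
  assumes "L > 0" "n \<ge> 1"
    and cont: "\<And>i j. i < n \<Longrightarrow> j < n \<Longrightarrow> continuous_on UNIV (g i j)"
    and eq: "\<And>i j z. i < n \<Longrightarrow> j < n \<Longrightarrow> z \<in> interior (element L n i j) \<Longrightarrow> f z = g i j z"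
  shows "(f has_integral (\<Sum>(i,j)\<in>{..<n} \<times> {..<n}. integral (element L n i j) (g i j))) (square L)"
proof -
  let ?U = "\<Union>(i,j)\<in>{..<n} \<times> {..<n}. interior (element L n i j)"
  have one: "(f has_integral integral (element L n i j) (g i j)) (interior (element L n i j))"
    if "i < n" "j < n" for i j
  proof -
    have "g i j integrable_on element L n i j"
      unfolding element_eq_cbox
      using cont[OF that] by (intro integrable_continuous) (rule continuous_on_subset, auto)
    then have "(g i j has_integral integral (element L n i j) (g i j)) (element L n i j)"
      by (rule integrable_integral)
    then have "(g i j has_integral integral (element L n i j) (g i j)) (interior (element L n i j))"
      by (subst has_integral_interior)
        (auto intro: negligible_convex_frontier convex_box simp: element_eq_cbox)
    then show ?thesis
      by (rule has_integral_eq[rotated]) (simp add: eq[OF that])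
  qed
  have "(f has_integral (\<Sum>p\<in>{..<n} \<times> {..<n}. (case p of (i,j) \<Rightarrow> integral (element L n i j) (g i j))))
          (\<Union>p\<in>{..<n} \<times> {..<n}. case p of (i,j) \<Rightarrow> interior (element L n i j))"
  proof (rule has_integral_UN)
    show "pairwise (\<lambda>p q. negligible ((case p of (i,j) \<Rightarrow> interior (element L n i j)) \<inter>
            (case q of (i,j) \<Rightarrow> interior (element L n i j)))) ({..<n} \<times> {..<n})"
      using interior_element_disjoint[OF assms(1)] by (auto simp: pairwise_def)
  qed (auto intro: one)
  then have "(f has_integral (\<Sum>(i,j)\<in>{..<n} \<times> {..<n}. integral (element L n i j) (g i j))) ?U"
    by (simp add: case_prod_beta)
  moreover have "?U \<subseteq> square L"
    using interior_element_subset_square[OF assms(1,2)] by auto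
  \<comment> \<open>The union of the open elements and the square differ only by a null set, so the
    domain of integration may be exchanged.\<close>
  then have "negligible {z \<in> ?U - square L. f z \<noteq> 0}"
    by (simp add: Diff_eq_empty_iff[THEN iffD2])
  moreover have "negligible {z \<in> square L - ?U. f z \<noteq> 0}"
    using negligible_grid[OF assms(1,2)] by (rule negligible_subset) auto
  ultimately show ?thesis
    using has_integral_spike_set_eq[of ?U "square L" f] by blast
qed

text \<open>Restricting to open elements makes the class closed under partial derivatives without
  any smoothness across grid lines. It therefore contains the Laplacian of a spline even for degree
  2, where second derivatives may jump.\<close>

definition piecewise_polynomial :: "real \<Rightarrow> nat \<Rightarrow> (real \<times> real \<Rightarrow> real) \<Rightarrow> bool" where
  "piecewise_polynomial L n f \<longleftrightarrow>
     (\<forall>i<n. \<forall>j<n. \<exists>g. real_polynomial_function g \<and> (\<forall>z\<in>interior (element L n i j). f z = g z))"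

section \<open>Closure properties and integrability of piecewise polynomials\<close>

lemma piecewise_polynomial_const: "piecewise_polynomial L n (\<lambda>z. c)"
  unfolding piecewise_polynomial_def by blast

lemma piecewise_polynomial_add:
  assumes "piecewise_polynomial L n f" "piecewise_polynomial L n g"
  shows "piecewise_polynomial L n (\<lambda>z. f z + g z)"
  unfolding piecewise_polynomial_def
proof (intro allI impI)
  fix i j assume "i < n" "j < n"
  with assms obtain a b where "real_polynomial_function a" "real_polynomial_function b"
    "\<forall>z\<in>interior (element L n i j). f z = a z" "\<forall>z\<in>interior (element L n i j). g z = b z"
    unfolding piecewise_polynomial_def by meson
  then show "\<exists>h. real_polynomial_function h \<and> (\<forall>z\<in>interior (element L n i j). f z + g z = h z)"
    by (intro exI[of _ "\<lambda>z. a z + b z"]) auto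
qed

lemma piecewise_polynomial_mult:
  assumes "piecewise_polynomial L n f" "piecewise_polynomial L n g"
  shows "piecewise_polynomial L n (\<lambda>z. f z * g z)"
  unfolding piecewise_polynomial_def
proof (intro allI impI)
  fix i j assume "i < n" "j < n"
  with assms obtain a b where "real_polynomial_function a" "real_polynomial_function b"
    "\<forall>z\<in>interior (element L n i j). f z = a z" "\<forall>z\<in>interior (element L n i j). g z = b z"
    unfolding piecewise_polynomial_def by meson
  then show "\<exists>h. real_polynomial_function h \<and> (\<forall>z\<in>interior (element L n i j). f z * g z = h z)"
    by (intro exI[of _ "\<lambda>z. a z * b z"]) auto
qed

lemma piecewise_polynomial_sum:
  assumes "finite I" "\<And>k. k \<in> I \<Longrightarrow> piecewise_polynomial L n (f k)"
  shows "piecewise_polynomial L n (\<lambda>z. \<Sum>k\<in>I. f k z)"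
  using assms
  by (induction I rule: finite_induct)
    (auto intro: piecewise_polynomial_const piecewise_polynomial_add)

lemma continuous_on_real_polynomial_function_compose:
  assumes "real_polynomial_function g" "continuous_on S f"
  shows "continuous_on S (\<lambda>x. g (f x))"
  using assms continuous_on_compose[of S f g]
  by (simp add: continuous_on_polymonial_function real_polynomial_function_eq o_def)

text \<open>Absolute integrability links the two integrals in use: \<open>L2_inner\<close> is a
  Lebesgue integral, while the elementwise computations use the gauge integral. Both
  \<open>f\<close> and \<open>norm f\<close> are continuous on each open element after replacing
  \<open>f\<close> by its polynomial.\<close>

lemma absolutely_integrable_piecewise_polynomial:
  assumes "L > 0" "n \<ge> 1" "piecewise_polynomial L n f"
  shows "f absolutely_integrable_on square L"
proof -
  from assms(3) obtain g
    where poly: "\<And>i j. i < n \<Longrightarrow> j < n \<Longrightarrow> real_polynomial_function (g i j)"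
      and eq: "\<And>i j z. i < n \<Longrightarrow> j < n \<Longrightarrow> z \<in> interior (element L n i j) \<Longrightarrow> f z = g i j z"
    unfolding piecewise_polynomial_def by metis
  have cont: "continuous_on UNIV (g i j)" if "i < n" "j < n" for i j
    using poly[OF that] by (simp add: continuous_on_polymonial_function real_polynomial_function_eq)
  have "f integrable_on square L"
    by (rule has_integral_integrable[OF has_integral_square_elementwise[where g = g]])
      (use assms cont eq in auto)
  moreover have "(\<lambda>z. norm (f z)) integrable_on square L"
    by (rule has_integral_integrable[OF has_integral_square_elementwise[where g = "\<lambda>i j z. norm (g i j z)"]])
      (use assms cont eq in \<open>auto intro!: continuous_intros\<close>)
  ultimately show ?thesis
    by (simp add: absolutely_integrable_on_def)
qed

section \<open>Partial derivatives\<close>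

text \<open>Induction over the construction of polynomials with the sum and product rules; a linear
  \<open>f\<close> has the constant derivative \<open>f e\<close>. The claim covers the whole line
  through \<open>z\<close>: \<open>t = 0\<close> yields the partial derivative, and all
  \<open>t\<close> together serve the fundamental theorem of calculus.\<close>

lemma real_polynomial_function_directional_derivative:
  assumes "real_polynomial_function f"
  obtains f' where "real_polynomial_function f'"
    "\<And>z t. ((\<lambda>t. f (z + t *\<^sub>R e)) has_real_derivative f' (z + t *\<^sub>R e)) (at t)"
proof -
  have "\<exists>f'. real_polynomial_function f' \<and>
      (\<forall>z t. ((\<lambda>t. f (z + t *\<^sub>R e)) has_real_derivative f' (z + t *\<^sub>R e)) (at t))"
    using assms
  proof (induction f rule: real_polynomial_function.induct)
    case (linear f)
    then interpret bounded_linear f .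
    show ?case
      by (intro exI[of _ "\<lambda>_. f e"]) (auto simp: add scaleR intro!: derivative_eq_intros)
  next
    case (const c)
    show ?case by (intro exI[of _ "\<lambda>_. 0"]) auto
  next
    case (add f g)
    then obtain f' g' where "real_polynomial_function f'" "real_polynomial_function g'"
      "\<And>z t. ((\<lambda>t. f (z + t *\<^sub>R e)) has_real_derivative f' (z + t *\<^sub>R e)) (at t)"
      "\<And>z t. ((\<lambda>t. g (z + t *\<^sub>R e)) has_real_derivative g' (z + t *\<^sub>R e)) (at t)"
      by blast
    then show ?case
      by (intro exI[of _ "\<lambda>z. f' z + g' z"]) (auto intro: DERIV_add)
  next
    case (mult f g)
    then obtain f' g' where "real_polynomial_function f'" "real_polynomial_function g'"
      "\<And>z t. ((\<lambda>t. f (z + t *\<^sub>R e)) has_real_derivative f' (z + t *\<^sub>R e)) (at t)"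
      "\<And>z t. ((\<lambda>t. g (z + t *\<^sub>R e)) has_real_derivative g' (z + t *\<^sub>R e)) (at t)"
      by blast
    then show ?case
      using mult.hyps
      by (intro exI[of _ "\<lambda>z. f' z * g z + g' z * f z"]) (auto intro: DERIV_mult)
  qed
  with that show ?thesis by blast
qed

text \<open>For small \<open>t\<close> the point \<open>z + t *\<^sub>R e\<close> stays in the open
  set \<open>S\<close>, so \<open>v\<close> and \<open>g\<close> agree along the line near
  \<open>t = 0\<close> and share the derivative there.\<close>

lemma partial_derivative_eq_on_open:
  assumes "open S" "z \<in> S" "\<And>w. w \<in> S \<Longrightarrow> v w = g w"
    and "((\<lambda>t. g (z + t *\<^sub>R e)) has_real_derivative D) (at 0)"
  shows "partial_derivative e v z = D"
proof -
  have "open ((\<lambda>t. z + t *\<^sub>R e) -` S)"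
    using assms(1) by (intro open_vimage) (auto intro!: continuous_intros)
  then have "eventually (\<lambda>t. t \<in> (\<lambda>t. z + t *\<^sub>R e) -` S) (nhds 0)"
    using assms(2) by (intro eventually_nhds_in_open) auto
  then have "eventually (\<lambda>t. v (z + t *\<^sub>R e) = g (z + t *\<^sub>R e)) (nhds 0)"
    by (rule eventually_mono) (simp add: assms(3))
  then have "((\<lambda>t. v (z + t *\<^sub>R e)) has_real_derivative D) (at 0)"
    using assms(4) by (subst DERIV_cong_ev[OF refl _ refl])
  then show ?thesis
    unfolding partial_derivative_def by (rule DERIV_imp_deriv)
qed

lemma piecewise_polynomial_partial_derivative:
  assumes "piecewise_polynomial L n f"
  shows "piecewise_polynomial L n (partial_derivative e f)"
  unfolding piecewise_polynomial_def
proof (intro allI impI)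
  fix i j assume "i < n" "j < n"
  with assms obtain g where g: "real_polynomial_function g"
    "\<And>z. z \<in> interior (element L n i j) \<Longrightarrow> f z = g z"
    unfolding piecewise_polynomial_def by meson
  obtain g' where g': "real_polynomial_function g'"
    "\<And>z t. ((\<lambda>t. g (z + t *\<^sub>R e)) has_real_derivative g' (z + t *\<^sub>R e)) (at t)"
    using real_polynomial_function_directional_derivative[OF g(1)] by blast
  have "partial_derivative e f z = g' z" if "z \<in> interior (element L n i j)" for z
    using partial_derivative_eq_on_open[where v = f and g = g and e = e and D = "g' z", OF open_interior that g(2)] g'(2)[of z 0] by simp
  with g'(1) show "\<exists>h. real_polynomial_function h \<and>
      (\<forall>z\<in>interior (element L n i j). partial_derivative e f z = h z)"
    by blast
qed

lemma inner_gradient: "\<beta> \<bullet> gradient v z = (\<Sum>i\<in>Basis. (\<beta> \<bullet> i) * partial_derivative i v z)"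
  by (simp add: gradient_def inner_sum_right mult.commute)

lemmas piecewise_polynomial_intros =
  piecewise_polynomial_const piecewise_polynomial_add piecewise_polynomial_mult
  piecewise_polynomial_sum piecewise_polynomial_partial_derivative

lemma piecewise_polynomial_inner_gradient:
  "piecewise_polynomial L n v \<Longrightarrow> piecewise_polynomial L n (\<lambda>z. \<beta> \<bullet> gradient v z)"
  unfolding inner_gradient by (intro piecewise_polynomial_intros) auto

lemma piecewise_polynomial_laplacian:
  "piecewise_polynomial L n v \<Longrightarrow> piecewise_polynomial L n (laplacian v)"
  unfolding laplacian_def by (intro piecewise_polynomial_intros) auto

section \<open>Splines and the convective term\<close>

text \<open>Agreement holds on the closed element, edges included. This is what later lets the edge
  terms of neighbouring elements be expressed through \<open>v\<close> itself and cancel.\<close>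

lemma spline_space_polynomial:
  assumes "v \<in> spline_space p L n" "i < n" "j < n"
  obtains g where "real_polynomial_function g" "\<And>z. z \<in> element L n i j \<Longrightarrow> v z = g z"
proof -
  from assms obtain c where c: "\<forall>(x, y)\<in>element L n i j.
      v (x, y) = (\<Sum>k\<le>p. \<Sum>l\<le>p. c k l * x ^ k * y ^ l)"
    unfolding spline_space_def by blast
  have "real_polynomial_function (\<lambda>z::real\<times>real. \<Sum>k\<le>p. \<Sum>l\<le>p. c k l * fst z ^ k * snd z ^ l)"
    by (intro real_polynomial_function_sum real_polynomial_function.intros(4)
        real_polynomial_function_power real_polynomial_function.intros(2)
        real_polynomial_function.intros(1) bounded_linear_fst bounded_linear_snd) auto
  with c that show ?thesis by fastforce
qed

lemma piecewise_polynomial_spline: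
  "v \<in> spline_space p L n \<Longrightarrow> piecewise_polynomial L n v"
  unfolding piecewise_polynomial_def
  using spline_space_polynomial interior_subset by (metis subsetD)

lemma spline_space_boundary:
  assumes "v \<in> spline_space p L n" "L > 0" "t \<in> {0..L}"
  shows "v (0, t) = 0" "v (L, t) = 0" "v (t, 0) = 0" "v (t, L) = 0"
proof -
  have "frontier (square L) = {0..L} \<times> {0..L} - {0<..<L} \<times> {0<..<L}"
    using assms(2)
    by (simp add: frontier_def square_def closure_Times interior_open open_Times)
  then show "v (0, t) = 0" "v (L, t) = 0" "v (t, 0) = 0" "v (t, L) = 0"
    using assms unfolding spline_space_def by auto
qed

section \<open>Vanishing of the convective term\<close>

lemma integral_mult_deriv:
  fixes f :: "real \<Rightarrow> real"
  assumes "a \<le> b" "\<And>t. (f has_real_derivative f' t) (at t)"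
  shows "integral {a..b} (\<lambda>t. f' t * f t) = (f b)\<^sup>2 / 2 - (f a)\<^sup>2 / 2"
proof (rule integral_unique, rule fundamental_theorem_of_calculus[OF assms(1)])
  fix t
  have "((\<lambda>t. (f t)\<^sup>2 / 2) has_real_derivative f' t * f t) (at t)"
    by (auto intro!: derivative_eq_intros assms(2))
  then show "((\<lambda>t. (f t)\<^sup>2 / 2) has_vector_derivative f' t * f t) (at t within {a..b})"
    by (simp add: has_real_derivative_iff_has_vector_derivative has_vector_derivative_at_within)
qed

lemma node_interval_subset:
  assumes "L > 0" "n \<ge> 1" "i < n"
  shows "{node L n i..node L n (Suc i)} \<subseteq> {0..L}"
  using node_mono[OF assms(1), of "Suc i" n n] node_mono[OF assms(1), of 0 i n]
    node_n[OF assms(2)] assms(3) by auto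

text \<open>The integrand is the derivative of \<open>v\<^sup>2 / 2\<close> in direction
  \<open>e\<close>. On each element, iterated integration leaves the difference of the integrals of
  \<open>v\<^sup>2 / 2\<close> over two opposite edges. These differences telescope along a row or
  column of elements down to edges on the boundary, where \<open>v\<close> is zero.\<close>

lemma integral_partial_derivative_mult_spline:
  assumes "L > 0" "n \<ge> 1" "v \<in> spline_space p L n" "e \<in> Basis"
  shows "integral (square L) (\<lambda>z. partial_derivative e v z * v z) = 0"
proof -
  have "\<exists>g. real_polynomial_function g \<and> (\<forall>z\<in>element L n i j. v z = g z)"
    if "i < n" "j < n" for i j
    by (rule spline_space_polynomial[OF assms(3) that]) blast
  then obtain g where g: "\<And>i j. i < n \<Longrightarrow> j < n \<Longrightarrow> real_polynomial_function (g i j)"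
    "\<And>i j z. i < n \<Longrightarrow> j < n \<Longrightarrow> z \<in> element L n i j \<Longrightarrow> v z = g i j z"
    by metis
  have "\<exists>g'. real_polynomial_function g' \<and>
      (\<forall>z t. ((\<lambda>t. g i j (z + t *\<^sub>R e)) has_real_derivative g' (z + t *\<^sub>R e)) (at t))"
    if "i < n" "j < n" for i j
    by (rule real_polynomial_function_directional_derivative[OF g(1)[OF that], where e = e]) blast
  then obtain g' where g': "\<And>i j. i < n \<Longrightarrow> j < n \<Longrightarrow> real_polynomial_function (g' i j)"
    "\<And>i j z t. i < n \<Longrightarrow> j < n \<Longrightarrow>
        ((\<lambda>t. g i j (z + t *\<^sub>R e)) has_real_derivative g' i j (z + t *\<^sub>R e)) (at t)"
    by metis
  have cont: "continuous_on UNIV (\<lambda>z. g' i j z * g i j z)" if "i < n" "j < n" for i j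
    using g(1)[OF that] g'(1)[OF that]
    by (intro continuous_intros)
      (simp_all add: continuous_on_polymonial_function real_polynomial_function_eq)
  have pd: "partial_derivative e v z = g' i j z"
    if "i < n" "j < n" "z \<in> interior (element L n i j)" for i j z
    using partial_derivative_eq_on_open[where v = v and g = "g i j" and e = e and D = "g' i j z",
        OF open_interior that(3)]
      g(2)[OF that(1,2)] g'(2)[OF that(1,2), of z 0] interior_subset by fastforce
  have total: "integral (square L) (\<lambda>z. partial_derivative e v z * v z) =
      (\<Sum>(i,j)\<in>{..<n} \<times> {..<n}. integral (element L n i j) (\<lambda>z. g' i j z * g i j z))"
  proof (intro integral_unique has_integral_square_elementwise assms(1,2) cont)
    show "partial_derivative e v z * v z = g' i j z * g i j z"
      if "i < n" "j < n" "z \<in> interior (element L n i j)" for i j z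
      using pd[OF that] g(2)[OF that(1,2)] interior_subset that(3) by fastforce
  qed
  have le: "node L n i \<le> node L n (Suc i)" for i
    by (rule node_mono[OF assms(1)]) simp
  have mem: "(x, y) \<in> element L n i j"
    if "x \<in> {node L n i..node L n (Suc i)}" "y \<in> {node L n j..node L n (Suc j)}" for x y i j
    using that by (simp add: element_eq_cbox cbox_Pair_eq)
  from assms(4) consider "e = (1, 0)" | "e = (0, 1)"
    by (auto simp: Basis_prod_def)
  then show ?thesis
  proof cases
    case 1
    \<comment> \<open>Integral of \<open>v\<^sup>2 / 2\<close> over a vertical edge. Using
      \<open>v\<close> rather than a polynomial piece gives both adjacent elements the same edge
      term.\<close>
    define T where "T i j = integral {node L n j..node L n (Suc j)} (\<lambda>y. (v (node L n i, y))\<^sup>2 / 2)" for i j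
    \<comment> \<open>Since \<open>x\<close> ranges over the closed interval, the piece of element
      \<open>(i, j)\<close> also handles its right edge, including the last one with
      \<open>Suc i = n\<close>.\<close>
    have intv: "(\<lambda>y. (v (x, y))\<^sup>2 / 2) integrable_on {node L n j..node L n (Suc j)}"
      if "i < n" "j < n" "x \<in> {node L n i..node L n (Suc i)}" for i j x
    proof (rule integrable_eq)
      show "(\<lambda>y. (g i j (x, y))\<^sup>2 / 2) integrable_on {node L n j..node L n (Suc j)}"
        by (intro integrable_continuous_interval continuous_intros
            continuous_on_real_polynomial_function_compose[OF g(1)[OF that(1,2)]]) auto
    qed (use g(2)[OF that(1,2)] mem[OF that(3)] in auto)
    have "integral (element L n i j) (\<lambda>z. g' i j z * g i j z) = T (Suc i) j - T i j"
      if ij: "i < n" "j < n" for i j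
    proof -
      have "integral (element L n i j) (\<lambda>z. g' i j z * g i j z) =
        integral {node L n i..node L n (Suc i)}
         (\<lambda>x. integral {node L n j..node L n (Suc j)} (\<lambda>y. g' i j (x, y) * g i j (x, y)))"
        unfolding element_eq_cbox
        by (subst integral_prod_continuous) (auto intro: continuous_on_subset[OF cont[OF ij]])
      \<comment> \<open>The order is swapped so that the inner integral runs in the direction of
        \<open>e\<close>, where the fundamental theorem applies.\<close>
      also have "\<dots> = integral {node L n j..node L n (Suc j)}
         (\<lambda>y. integral {node L n i..node L n (Suc i)} (\<lambda>x. g' i j (x, y) * g i j (x, y)))"
        using integral_swap_continuous[of "node L n i" "node L n j" "node L n (Suc i)"
            "node L n (Suc j)" "\<lambda>x y. g' i j (x, y) * g i j (x, y)"]
          continuous_on_subset[OF cont[OF ij]] by (simp add: case_prod_beta')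
      also have "\<dots> = integral {node L n j..node L n (Suc j)}
         (\<lambda>y. (v (node L n (Suc i), y))\<^sup>2 / 2 - (v (node L n i, y))\<^sup>2 / 2)"
      proof (rule integral_cong)
        fix y assume y: "y \<in> {node L n j..node L n (Suc j)}"
        have "((\<lambda>t. g i j (t, y)) has_real_derivative g' i j (t, y)) (at t)" for t
          using g'(2)[OF ij, of "(0, y)" t] 1 by simp
        from integral_mult_deriv[OF le this]
        show "integral {node L n i..node L n (Suc i)} (\<lambda>x. g' i j (x, y) * g i j (x, y)) =
            (v (node L n (Suc i), y))\<^sup>2 / 2 - (v (node L n i, y))\<^sup>2 / 2"
          using g(2)[OF ij mem[OF _ y]] le by simp
      qed
      also have "\<dots> = T (Suc i) j - T i j"
        unfolding T_def using le by (intro integral_diff intv[OF ij]) auto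
      finally show ?thesis .
    qed
    then have "integral (square L) (\<lambda>z. partial_derivative e v z * v z) =
        (\<Sum>(i,j)\<in>{..<n} \<times> {..<n}. T (Suc i) j - T i j)"
      unfolding total by (intro sum.cong) auto
    also have "\<dots> = (\<Sum>j<n. \<Sum>i<n. T (Suc i) j - T i j)"
      by (subst sum.cartesian_product[symmetric]) (rule sum.swap)
    also have "\<dots> = (\<Sum>j<n. T n j - T 0 j)"
      using sum_lessThan_telescope[of "\<lambda>i. T i j" n for j] by simp
    also have "\<dots> = 0"
    proof (rule sum.neutral, rule ballI)
      fix j assume "j \<in> {..<n}"
      \<comment> \<open>Zero boundary values are available only on the sides of the square, so the
        edge must be seen to lie within \<open>{0..L}\<close>.\<close>
      then have sub: "{node L n j..node L n (Suc j)} \<subseteq> {0..L}"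
        using node_interval_subset[OF assms(1,2)] by simp
      have "T n j = integral {node L n j..node L n (Suc j)} (\<lambda>y. 0)"
        "T 0 j = integral {node L n j..node L n (Suc j)} (\<lambda>y. 0)"
        unfolding T_def node_0 node_n[OF assms(2)]
        by (rule integral_cong; use sub spline_space_boundary[OF assms(3,1)] in force)+
      then show "T n j - T 0 j = 0" by simp
    qed
    finally show ?thesis .
  next
    case 2
    \<comment> \<open>Now the edges are horizontal. The inner integral already runs in the direction
      of \<open>e\<close>, so no swap is required.\<close>
    define T where "T i j = integral {node L n i..node L n (Suc i)} (\<lambda>x. (v (x, node L n j))\<^sup>2 / 2)" for i j
    have intv: "(\<lambda>x. (v (x, y))\<^sup>2 / 2) integrable_on {node L n i..node L n (Suc i)}"
      if "i < n" "j < n" "y \<in> {node L n j..node L n (Suc j)}" for i j y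
    proof (rule integrable_eq)
      show "(\<lambda>x. (g i j (x, y))\<^sup>2 / 2) integrable_on {node L n i..node L n (Suc i)}"
        by (intro integrable_continuous_interval continuous_intros
            continuous_on_real_polynomial_function_compose[OF g(1)[OF that(1,2)]]) auto
    qed (use g(2)[OF that(1,2)] mem[OF _ that(3)] in auto)
    have "integral (element L n i j) (\<lambda>z. g' i j z * g i j z) = T i (Suc j) - T i j"
      if ij: "i < n" "j < n" for i j
    proof -
      have "integral (element L n i j) (\<lambda>z. g' i j z * g i j z) =
        integral {node L n i..node L n (Suc i)}
         (\<lambda>x. integral {node L n j..node L n (Suc j)} (\<lambda>y. g' i j (x, y) * g i j (x, y)))"
        unfolding element_eq_cbox
        by (subst integral_prod_continuous) (auto intro: continuous_on_subset[OF cont[OF ij]])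
      also have "\<dots> = integral {node L n i..node L n (Suc i)}
         (\<lambda>x. (v (x, node L n (Suc j)))\<^sup>2 / 2 - (v (x, node L n j))\<^sup>2 / 2)"
      proof (rule integral_cong)
        fix x assume x: "x \<in> {node L n i..node L n (Suc i)}"
        have "((\<lambda>t. g i j (x, t)) has_real_derivative g' i j (x, t)) (at t)" for t
          using g'(2)[OF ij, of "(x, 0)" t] 2 by simp
        from integral_mult_deriv[OF le this]
        show "integral {node L n j..node L n (Suc j)} (\<lambda>y. g' i j (x, y) * g i j (x, y)) =
            (v (x, node L n (Suc j)))\<^sup>2 / 2 - (v (x, node L n j))\<^sup>2 / 2"
          using g(2)[OF ij mem[OF x]] le by simp
      qed
      also have "\<dots> = T i (Suc j) - T i j"
        unfolding T_def using le by (intro integral_diff intv[OF ij]) auto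
      finally show ?thesis .
    qed
    then have "integral (square L) (\<lambda>z. partial_derivative e v z * v z) =
        (\<Sum>(i,j)\<in>{..<n} \<times> {..<n}. T i (Suc j) - T i j)"
      unfolding total by (intro sum.cong) auto
    also have "\<dots> = (\<Sum>i<n. \<Sum>j<n. T i (Suc j) - T i j)"
      by (rule sum.cartesian_product[symmetric])
    also have "\<dots> = (\<Sum>i<n. T i n - T i 0)"
      by (simp only: sum_lessThan_telescope)
    also have "\<dots> = 0"
    proof (rule sum.neutral, rule ballI)
      fix i assume "i \<in> {..<n}"
      then have sub: "{node L n i..node L n (Suc i)} \<subseteq> {0..L}"
        using node_interval_subset[OF assms(1,2)] by simp
      have "T i n = integral {node L n i..node L n (Suc i)} (\<lambda>x. 0)"
        "T i 0 = integral {node L n i..node L n (Suc i)} (\<lambda>x. 0)"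
        unfolding T_def node_0 node_n[OF assms(2)]
        by (rule integral_cong; use sub spline_space_boundary[OF assms(3,1)] in force)+
      then show "T i n - T i 0 = 0" by simp
    qed
    finally show ?thesis .
  qed
qed

text \<open>Because \<open>\<beta>\<close> is constant, its components leave the integral and each
  coordinate direction contributes zero.\<close>

lemma L2_inner_convection_eq_0:
  assumes "L > 0" "n \<ge> 1" "v \<in> spline_space p L n"
  shows "L2_inner (square L) (\<lambda>z. \<beta> \<bullet> gradient v z) v = 0"
proof -
  note pp = piecewise_polynomial_spline[OF assms(3)]
  have int: "(\<lambda>z. partial_derivative e v z * v z) absolutely_integrable_on square L" for e
    by (intro absolutely_integrable_piecewise_polynomial[OF assms(1,2)] piecewise_polynomial_intros pp)
  have "(\<lambda>z. (\<beta> \<bullet> gradient v z) * v z) absolutely_integrable_on square L"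
    by (intro absolutely_integrable_piecewise_polynomial[OF assms(1,2)] piecewise_polynomial_intros
        piecewise_polynomial_inner_gradient pp)
  then have "L2_inner (square L) (\<lambda>z. \<beta> \<bullet> gradient v z) v =
      integral (square L) (\<lambda>z. (\<beta> \<bullet> gradient v z) * v z)"
    unfolding L2_inner_def by (simp add: set_lebesgue_integral_eq_integral)
  also have "\<dots> = integral (square L)
      (\<lambda>z. \<Sum>e\<in>Basis. (\<beta> \<bullet> e) * (partial_derivative e v z * v z))"
    unfolding inner_gradient sum_distrib_right mult.assoc ..
  also have "\<dots> = (\<Sum>e\<in>Basis. (\<beta> \<bullet> e) * integral (square L) (\<lambda>z. partial_derivative e v z * v z))"
    using int
    by (subst integral_sum)
      (auto intro!: integrable_on_cmult_left set_lebesgue_integral_eq_integral(1))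
  also have "\<dots> = 0"
    by (simp add: integral_partial_derivative_mult_spline[OF assms])
  finally show ?thesis .
qed

section \<open>L2 estimates and the lower bound for the least-squares term\<close>

lemma L2_inner_self_nonneg: "L2_inner S f f \<ge> 0"
  unfolding L2_inner_def set_lebesgue_integral_def
  by (rule integral_nonneg_AE) (simp add: indicator_def)

lemma L2_norm_nonneg: "L2_norm S f \<ge> 0"
  by (simp add: L2_norm_def L2_inner_self_nonneg)

lemma L2_norm_power2: "(L2_norm S f)\<^sup>2 = L2_inner S f f"
  by (simp add: L2_norm_def L2_inner_self_nonneg)

text \<open>A Young inequality for the square of the strong residual, to be applied with
  \<open>a\<close> the Laplacian and \<open>w\<close> the convective derivative. Keeping half of
  \<open>w\<close> costs \<open>\<epsilon>\<^sup>2\<close> times the squared norm of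
  \<open>a\<close>.\<close>

lemma L2_inner_least_squares_ge:
  fixes a w :: "real \<times> real \<Rightarrow> real"
  assumes "L > 0" "n \<ge> 1" "piecewise_polynomial L n a" "piecewise_polynomial L n w"
  shows "L2_inner (square L) (\<lambda>z. - \<epsilon> * a z + w z) (\<lambda>z. - \<epsilon> * a z + w z) \<ge>
    1 / 2 * L2_inner (square L) w w - \<epsilon>\<^sup>2 * L2_inner (square L) a a"
proof -
  note ai = absolutely_integrable_piecewise_polynomial[OF assms(1,2)]
  have a: "(\<lambda>z. a z * a z) absolutely_integrable_on square L"
    and w: "(\<lambda>z. w z * w z) absolutely_integrable_on square L"
    and aw: "(\<lambda>z. (- \<epsilon> * a z + w z) * (- \<epsilon> * a z + w z)) absolutely_integrable_on square L"
    by (intro ai piecewise_polynomial_intros assms)+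
  have "(LINT z:square L|lebesgue. 1 / 2 * (w z * w z) - \<epsilon>\<^sup>2 * (a z * a z)) \<le>
      (LINT z:square L|lebesgue. (- \<epsilon> * a z + w z) * (- \<epsilon> * a z + w z))"
  proof (rule set_integral_mono)
    show "set_integrable lebesgue (square L) (\<lambda>z. 1 / 2 * (w z * w z) - \<epsilon>\<^sup>2 * (a z * a z))"
      using a w by (intro set_integral_diff set_integrable_mult_right) auto
    fix z
    \<comment> \<open>This square is exactly the right integrand minus the left one.\<close>
    have "0 \<le> (w z - 2 * \<epsilon> * a z)\<^sup>2 / 2" by simp
    then show "1 / 2 * (w z * w z) - \<epsilon>\<^sup>2 * (a z * a z) \<le> (- \<epsilon> * a z + w z) * (- \<epsilon> * a z + w z)"
      by (simp add: power2_eq_square algebra_simps)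
  qed (rule aw)
  moreover have "(LINT z:square L|lebesgue. 1 / 2 * (w z * w z) - \<epsilon>\<^sup>2 * (a z * a z)) =
      1 / 2 * (LINT z:square L|lebesgue. w z * w z) - \<epsilon>\<^sup>2 * (LINT z:square L|lebesgue. a z * a z)"
    using a w by (subst set_integral_diff) auto
  ultimately show ?thesis
    by (simp add: L2_inner_def)
qed

section \<open>Coercivity of the stabilised bilinear form\<close>

theorem theorem1:
  fixes L \<epsilon> C :: real and \<beta> :: "real \<times> real" and p n :: nat
  assumes "L > 0"
    and "\<epsilon> > 0"
    and "p \<ge> 2"
    and "C > 0"
    and "\<And>m v. m \<ge> 1 \<Longrightarrow> v \<in> spline_space p L m \<Longrightarrow>
           L2_norm (square L) (laplacian v)
             \<le> C * inverse (element_size L m) * L2_norm (square L) (gradient v)"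
    and "n \<ge> 1"
    and "\<epsilon> \<le> 1 / 2 * (element_size L n / C\<^sup>2)"
  shows "\<forall>v\<in>spline_space p L n.
    bilinear_form L n \<epsilon> \<beta> v v \<ge>
      1 / 2 * (\<epsilon> / element_size L n * (L2_norm (square L) (gradient v))\<^sup>2
               + (L2_norm (square L) (\<lambda>z. \<beta> \<bullet> gradient v z))\<^sup>2)"
proof
  fix v assume v: "v \<in> spline_space p L n"
  define h where "h = element_size L n"
  define G where "G = L2_inner (square L) (gradient v) (gradient v)"
  define A where "A = L2_inner (square L) (laplacian v) (laplacian v)"
  define W where "W = L2_inner (square L) (\<lambda>z. \<beta> \<bullet> gradient v z) (\<lambda>z. \<beta> \<bullet> gradient v z)"
  have h: "h > 0" using assms(1,6) by (simp add: h_def element_size_def)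
  have G: "G \<ge> 0" unfolding G_def by (rule L2_inner_self_nonneg)
  note pp = piecewise_polynomial_spline[OF v]
  from assms(5)[OF assms(6) v] L2_norm_nonneg
  have "(L2_norm (square L) (laplacian v))\<^sup>2 \<le>
      (C * inverse h * L2_norm (square L) (gradient v))\<^sup>2"
    unfolding h_def by (intro power_mono)
  then have "A \<le> C\<^sup>2 / h\<^sup>2 * G"
    by (simp add: power_mult_distrib L2_norm_power2 A_def G_def power_inverse field_simps)
  then have "\<epsilon>\<^sup>2 * A \<le> \<epsilon>\<^sup>2 * (C\<^sup>2 / h\<^sup>2 * G)"
    by (rule mult_left_mono) simp
  \<comment> \<open>One factor \<open>\<epsilon>\<close> is paired with \<open>C\<^sup>2\<close>, so
    that the bound on \<open>\<epsilon>\<close> turns it into \<open>h / 2\<close>; the other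
    survives as the weight of the diffusion term.\<close>
  also have "\<dots> = (\<epsilon> * C\<^sup>2) * (\<epsilon> / h\<^sup>2 * G)"
    by (simp add: power2_eq_square)
  also have "\<dots> \<le> h / 2 * (\<epsilon> / h\<^sup>2 * G)"
    using assms(2,4,7) G h by (intro mult_right_mono) (auto simp: h_def field_simps)
  also have "\<dots> = 1 / 2 * (\<epsilon> / h * G)"
    using h by (simp add: power2_eq_square)
  finally have "\<epsilon>\<^sup>2 * A \<le> 1 / 2 * (\<epsilon> / h * G)" .
  \<comment> \<open>The convective part of the Galerkin term is zero, so the full diffusion term
    remains; half of it then absorbs \<open>\<epsilon>\<^sup>2 * A\<close>.\<close>
  moreover have "bilinear_form L n \<epsilon> \<beta> v v \<ge> \<epsilon> / h * G + (1 / 2 * W - \<epsilon>\<^sup>2 * A)"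
    using L2_inner_least_squares_ge[OF assms(1,6) piecewise_polynomial_laplacian[OF pp]
        piecewise_polynomial_inner_gradient[OF pp], of \<beta> \<epsilon>]
      L2_inner_convection_eq_0[OF assms(1,6) v, of \<beta>]
    unfolding bilinear_form_def h_def[symmetric] G_def A_def W_def by simp
  ultimately show "bilinear_form L n \<epsilon> \<beta> v v \<ge>
      1 / 2 * (\<epsilon> / element_size L n * (L2_norm (square L) (gradient v))\<^sup>2
               + (L2_norm (square L) (\<lambda>z. \<beta> \<bullet> gradient v z))\<^sup>2)"
    unfolding L2_norm_power2 h_def[symmetric] G_def[symmetric] W_def[symmetric] by argo
qed

end
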